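(* There exist constants $c,c',\epsilon_0>0$ such that the following holds. Let $\epsilon,R\in\mathbb{R}$ and $\beta=1+\epsilon+iR$. If either (a) $0<\epsilon\le\epsilon_0$ and $c\sqrt{\epsilon}\le R\le \dfrac{c'}{\sqrt{\epsilon}}$, or (b) $\epsilon<0$, then, as $N\to\infty$, $$Z_{\beta,N}=\sqrt{\frac{\beta}{\beta-\beta^2}}\,\bigl(1+o_{\epsilon,R}(1)\bigr),\qquad\text{and}\qquad \lim_{N\to\infty}\frac1N\log|Z_{\beta,N}|=0 .$$
   Context: For an integer $N\ge1$ and $\beta\in\mathbb{C}$, the Curie–Weiss partition function is $$Z_{\beta,N}=\frac1{2^N}\sum_{\sigma\in\{-1,+1\}^N}\exp(-\beta H_N(\sigma)),\qquad H_N(\sigma)=-\frac1{2N}\sum_{i,j=1}^N\sigma_i\sigma_j .$$ The notation $o_{\epsilon,R}(1)$ denotes a quantity tending to $0$ as $N\to\infty$ for fixed $\epsilon,R$ (the rate may depend on $\epsilon$ and $R$). The square root is the principal branch ($\sqrt1=1$). For $\beta=0$ the ratio $\beta/(\beta-\beta^2)$ is read as $1/(1-\beta)=1$. *)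

theory Defs
  imports Complex_Main "HOL-Library.FuncSet"
begin

definition spins :: "nat \<Rightarrow> (nat \<Rightarrow> real) set" where
  "spins N = {1..N} \<rightarrow>\<^sub>E {-1, 1}"

definition cw_energy :: "nat \<Rightarrow> (nat \<Rightarrow> real) \<Rightarrow> real" where
  "cw_energy N \<sigma> = - (1 / (2 * real N)) * (\<Sum>i=1..N. \<Sum>j=1..N. \<sigma> i * \<sigma> j)"

definition cw_partition :: "complex \<Rightarrow> nat \<Rightarrow> complex" where
  "cw_partition \<beta> N =
     1 / 2 ^ N * (\<Sum>\<sigma>\<in>spins N. exp (- \<beta> * complex_of_real (cw_energy N \<sigma>)))"

text \<open>The removable singularity of \<open>\<beta> / (\<beta> - \<beta>\<^sup>2)\<close> at \<open>\<beta> = 0\<close> is filled in with its limit 1;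
  the bare Isabelle quotient would be 0 there.\<close>

definition cw_ratio :: "complex \<Rightarrow> complex" where
  "cw_ratio \<beta> = (if \<beta> = 0 then 1 else \<beta> / (\<beta> - \<beta>\<^sup>2))"

end

theory Submission
  imports Defs "HOL-Probability.Probability"
begin

text \<open>Write \<open>S = \<Sigma> \<sigma>\<^sub>i\<close>, so that \<open>cw_partition \<beta> N\<close> is the expectation of \<open>exp (\<beta> S\<^sup>2 / (2 N))\<close>
  under the uniform measure. Both conclusions follow once the partition function is shown to converge
  to \<open>csqrt (cw_ratio \<beta>)\<close>, that is, to the principal root of \<open>1 / (1 - \<beta>)\<close>, which is nonzero. This is
  the value that replacing \<open>S / sqrt N\<close> by a standard normal variable suggests.

  If \<open>Re \<beta> \<le> 0\<close>, the integrand \<open>exp (\<beta> x\<^sup>2 / 2)\<close> is bounded and continuous, and the convergence is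
  that of \<open>S / sqrt N\<close> in distribution (\<open>cw_partition_tendsto_nonpos\<close>).

  If \<open>Re \<beta> > 0\<close>, the Hubbard-Stratonovich identity (\<open>hubbard_stratonovich\<close>) expresses the partition
  function through the integral over real \<open>s\<close> of \<open>g (s / sqrt N) ^ N\<close>, where
  \<open>g m = exp (- \<beta> m\<^sup>2 / 2) * cosh (\<beta> m)\<close>. The choice of contour matters: in the usual variable
  \<open>y = \<beta> m\<close> the path of integration is the line spanned by \<open>\<beta>\<close>, on which the linear term
  \<open>\<beta> m S\<close> is completed to a square by a \<^emph>\<open>real\<close> translation. The integrand tends pointwise to
  \<open>exp (- (\<beta> - \<beta>\<^sup>2) s\<^sup>2 / 2)\<close>, and a bound \<open>\<bar>g m\<bar> \<le> exp (- k m\<^sup>2)\<close> with \<open>k > 0\<close>, valid for all real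
  \<open>m\<close>, yields domination (\<open>cw_partition_tendsto_if_gaussian_decay\<close>).

  It remains to prove that bound, starting from
  \<open>\<bar>g m\<bar>\<^sup>2 = exp (- a m\<^sup>2) * ((cosh (a m))\<^sup>2 - (sin (R m))\<^sup>2)\<close> with \<open>a = Re \<beta>\<close> and \<open>R = Im \<beta>\<close>. For
  \<open>a < 1\<close> the inequality \<open>cosh x \<le> exp (x\<^sup>2 / 2)\<close> is enough. For \<open>a = 1 + \<epsilon>\<close> slightly larger than 1 that
  inequality only gives \<open>\<bar>g m\<bar>\<^sup>2 \<le> exp (a \<epsilon> m\<^sup>2)\<close>, and this growth is compensated by the sine when
  \<open>m\<^sup>2\<close> is of order at most \<open>\<epsilon>\<close>, which requires \<open>R\<close> to be a large multiple of \<open>sqrt \<epsilon>\<close> while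
  \<open>\<bar>R m\<bar>\<close> stays at most 1, hence \<open>R\<close> to be at most a small multiple of \<open>1 / sqrt \<epsilon>\<close>. For larger \<open>m\<close> the
  fourth-order deficit of \<open>cosh x\<close> against \<open>exp (x\<^sup>2 / 2)\<close> takes over (\<open>decay_supercritical\<close>).\<close>

section \<open>Inequalities for hyperbolic and circular functions\<close>

lemma two_power_mult_fact_le: "2 ^ n * fact n \<le> (fact (2 * n) :: real)"
proof (induction n)
  case (Suc n)
  have "2 ^ Suc n * fact (Suc n) = (2 * real (Suc n)) * (2 ^ n * fact n)"
    by (simp add: algebra_simps)
  also have "\<dots> \<le> (real (2 * n + 2) * real (2 * n + 1)) * fact (2 * n)"
    using Suc by (intro mult_mono) (auto simp: algebra_simps)
  also have "\<dots> = fact (2 * Suc n)" by (simp add: algebra_simps)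
  finally show ?case .
qed simp

lemma cosh_sums_even:
  fixes x :: real
  shows "(\<lambda>n. x ^ (2 * n) / fact (2 * n)) sums cosh x"
proof -
  have "strict_mono ((*) (2::nat))" by (auto simp: strict_mono_def)
  then have "(\<lambda>n. (\<lambda>n. if even n then x ^ n /\<^sub>R fact n else 0) (2 * n)) sums cosh x \<longleftrightarrow>
        (\<lambda>n. if even n then x ^ n /\<^sub>R fact n else 0) sums cosh x"
    by (rule sums_mono_reindex) (auto elim!: evenE)
  then show ?thesis using cosh_converges[of x] by (simp add: field_simps)
qed

text \<open>In the difference of the two power series every coefficient is nonnegative, and the one of
  \<open>x ^ 4\<close> is \<open>1 / 8 - 1 / 24 = 1 / 12\<close>.\<close>

lemma cosh_add_quartic_le_exp:
  fixes x :: real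
  shows "cosh x + x ^ 4 / 12 \<le> exp (x\<^sup>2 / 2)"
proof -
  let ?d = "\<lambda>n. (x\<^sup>2 / 2) ^ n / fact n - x ^ (2 * n) / fact (2 * n)"
  have e: "?d n = x ^ (2 * n) * (1 / (2 ^ n * fact n) - 1 / fact (2 * n))" for n
    by (simp add: power_divide field_simps flip: power_mult)
  have "(\<lambda>n. (x\<^sup>2 / 2) ^ n / fact n) sums exp (x\<^sup>2 / 2)"
    using exp_converges[of "x\<^sup>2 / 2"] by (simp add: field_simps)
  then have s: "?d sums (exp (x\<^sup>2 / 2) - cosh x)"
    by (intro sums_diff cosh_sums_even)
  have nn: "?d n \<ge> 0" for n
    unfolding e using two_power_mult_fact_le[of n]
    by (intro mult_nonneg_nonneg) (auto simp: field_simps power_mult)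
  have "sum ?d {2} \<le> suminf ?d"
    using s nn by (intro sum_le_suminf) (auto dest: sums_summable)
  moreover have "sum ?d {2} = x ^ 4 / 12"
  proof -
    have "(x\<^sup>2 / 2)\<^sup>2 = x ^ 4 / 4" by (simp add: power_divide flip: power_mult)
    then show ?thesis by (simp add: fact_numeral numeral_eq_Suc)
  qed
  ultimately show ?thesis using sums_unique[OF s] by linarith
qed

lemma cosh_le_exp_quartic:
  fixes x :: real
  shows "cosh x \<le> exp (x\<^sup>2 / 2 - x ^ 4 * exp (- (x\<^sup>2 / 2)) / 12)"
proof -
  have "cosh x \<le> exp (x\<^sup>2 / 2) * (1 + - (x ^ 4 * exp (- (x\<^sup>2 / 2)) / 12))"
    using cosh_add_quartic_le_exp[of x] by (simp add: algebra_simps flip: exp_add)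
  also have "\<dots> \<le> exp (x\<^sup>2 / 2) * exp (- (x ^ 4 * exp (- (x\<^sup>2 / 2)) / 12))"
    by (intro mult_left_mono exp_ge_add_one_self) auto
  finally show ?thesis by (simp flip: exp_add)
qed

lemma cosh_le_exp_half_square: "cosh (x::real) \<le> exp (x\<^sup>2 / 2)"
proof -
  have "0 \<le> x ^ 4 / 12" by simp
  then show ?thesis using cosh_add_quartic_le_exp[of x] by linarith
qed

lemma half_abs_le_abs_sin:
  fixes y :: real
  assumes "\<bar>y\<bar> \<le> 1"
  shows "\<bar>y\<bar> / 2 \<le> \<bar>sin y\<bar>"
proof -
  have *: "x / 2 \<le> sin x" if "0 \<le> x" "x \<le> 1" for x :: real
  proof -
    have 1: "\<bar>sin x - (\<Sum>m<3. (sin_coeff m) * x ^ m)\<bar> \<le> inverse (fact 3) * \<bar>x\<bar> ^ 3"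
      by (rule Maclaurin_sin_bound)
    have "x * (x * x) \<le> x * 1" using that by (intro mult_left_mono mult_le_one) auto
    then show ?thesis
      using 1 that by (simp add: sin_coeff_def lessThan_nat_numeral fact_numeral power3_eq_cube abs_if split: if_splits)
  qed
  show ?thesis using *[of "\<bar>y\<bar>"] assms by (auto simp: abs_if split: if_splits)
qed

lemma norm_cosh_squared:
  "(cmod (cosh z))\<^sup>2 = (cosh (Re z))\<^sup>2 - (sin (Im z))\<^sup>2"
proof -
  have "cmod (cosh z) ^ 2 = cos (Im z) ^ 2 + (sinh (Re z))\<^sup>2"
    unfolding cosh_conv_cos norm_cos_squared
    by (simp add: sinh_def exp_minus power_divide power_mult_distrib)
  then show ?thesis by (simp add: cos_squared_eq sinh_square_eq)
qed

section \<open>The Gaussian integral with complex parameter\<close>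

lemma gbinomial_minus_half:
  "(- (1 / 2) gchoose n) * (- 1) ^ n = (fact (2 * n) / (2 ^ n * fact n) / (2 ^ n * fact n) :: complex)"
proof (induction n)
  case (Suc n)
  have g: "(- (1 / 2) gchoose Suc n) * of_nat (Suc n) = (- (1 / 2) - of_nat n) * (- (1 / 2) gchoose n :: complex)"
    using gbinomial_mult_1[of "-(1/2)::complex" n] by (simp add: algebra_simps)
  have nz: "of_nat (Suc n) \<noteq> (0::complex)" by (simp del: of_nat_Suc)
  have "(- (1 / 2) gchoose Suc n) * (- 1) ^ Suc n * of_nat (Suc n) =
      (1 / 2 + of_nat n) * ((- (1 / 2) gchoose n) * (- 1) ^ n :: complex)"
  proof -
    have "(- (1 / 2) gchoose Suc n) * (- 1) ^ Suc n * of_nat (Suc n) =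
        - ((- 1) ^ n) * ((- (1 / 2) gchoose Suc n) * of_nat (Suc n) :: complex)"
      by (simp only: power_Suc) (simp only: mult_ac mult_minus_left mult_minus_right mult_1_left)
    also have "\<dots> = (1 / 2 + of_nat n) * ((- (1 / 2) gchoose n) * (- 1) ^ n)"
      unfolding g by (simp add: algebra_simps)
    finally show ?thesis .
  qed
  also have "\<dots> = (1 / 2 + of_nat n) * (fact (2 * n) / (2 ^ n * fact n) / (2 ^ n * fact n))"
    by (simp only: Suc.IH)
  also have "\<dots> = fact (2 * Suc n) / (2 ^ Suc n * fact (Suc n)) / (2 ^ Suc n * fact (Suc n)) * of_nat (Suc n)"
    using nz by (simp add: divide_simps del: of_nat_Suc) (simp add: algebra_simps)
  finally show ?case by (rule mult_right_cancel[OF nz, THEN iffD1])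
qed simp

lemma fact_double_le: "fact (2 * n) \<le> (2 ^ n * fact n) * (2 ^ n * fact n :: real)"
proof (induction n)
  case (Suc n)
  have "fact (2 * Suc n) = (real (2 * n + 2) * real (2 * n + 1)) * fact (2 * n)"
    by (simp add: algebra_simps)
  also have "\<dots> \<le> (real (2 * n + 2) * real (2 * n + 2)) * ((2 ^ n * fact n) * (2 ^ n * fact n))"
    using Suc by (intro mult_mono) auto
  also have "\<dots> = (2 ^ Suc n * fact (Suc n)) * (2 ^ Suc n * fact (Suc n))"
    by (simp add: algebra_simps)
  finally show ?case .
qed simp

text \<open>Expanding the exponential and integrating term by term against the even normal moments gives the
  binomial series of \<open>(1 - z) powr (- 1 / 2)\<close>. On the unit disc \<open>1 - z\<close> has positive real part, so the
  branch of the root is settled without a continuity argument.\<close>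

lemma gaussian_expectation_exp_square_disc:
  fixes z :: complex
  assumes "cmod z < 1"
  shows "has_bochner_integral lborel
      (\<lambda>x. of_real (std_normal_density x) * exp (z * of_real (x\<^sup>2) / 2)) (csqrt (1 / (1 - z)))"
proof -
  let ?c = "\<lambda>n. z ^ n / (2 ^ n * fact n)"
  define f where "f n x = ?c n * of_real (std_normal_density x * x ^ (2 * n))" for n and x :: real
  have b: "has_bochner_integral lborel (f n) (?c n * of_real (fact (2 * n) / (2 ^ n * fact n)))" for n
    unfolding f_def
    by (intro has_bochner_integral_mult_right has_bochner_integral_of_real std_normal_moment_even)
  have nf: "norm (f n x) = cmod (?c n) * (std_normal_density x * x ^ (2 * n))" for n x
    unfolding f_def norm_mult norm_of_real by (simp add: power_mult)
  have bn: "(\<integral>x. norm (f n x) \<partial>lborel) = cmod (?c n) * (fact (2 * n) / (2 ^ n * fact n))" for n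
    unfolding nf using has_bochner_integral_integral_eq[OF std_normal_moment_even[of n]] by simp
  have bn_le: "(\<integral>x. norm (f n x) \<partial>lborel) \<le> cmod z ^ n" for n
  proof -
    have "(\<integral>x. norm (f n x) \<partial>lborel) =
        cmod z ^ n * (fact (2 * n) / ((2 ^ n * fact n) * (2 ^ n * fact n)))"
      by (simp add: bn norm_divide norm_mult norm_power)
    also have "\<dots> \<le> cmod z ^ n * 1"
      using fact_double_le[of n] by (intro mult_left_mono) (auto simp: divide_le_eq_1)
    finally show ?thesis by simp
  qed
  have pt: "(\<lambda>n. f n x) sums (of_real (std_normal_density x) * exp (z * of_real (x\<^sup>2) / 2))" for x
  proof -
    have "(\<lambda>n. of_real (std_normal_density x) * ((z * of_real (x\<^sup>2) / 2) ^ n /\<^sub>R fact n)) sums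
        (of_real (std_normal_density x) * exp (z * of_real (x\<^sup>2) / 2))"
      by (intro sums_mult exp_converges)
    then show ?thesis
      by (simp add: f_def power_mult_distrib power_divide scaleR_conv_of_real field_simps flip: power_mult)
  qed
  have ns: "summable (\<lambda>n. norm (f n x))" for x
  proof -
    have "summable (\<lambda>n. std_normal_density x * norm ((z * of_real (x\<^sup>2) / 2) ^ n /\<^sub>R fact n))"
      by (intro summable_mult summable_norm_exp)
    moreover have "\<bar>x\<bar> ^ (n * 2) = x ^ (n * 2)" for n by (simp add: power_even_abs)
    ultimately show ?thesis
      by (simp add: nf norm_divide norm_mult norm_power power_mult_distrib power_divide field_simps flip: power_mult)
  qed
  have s: "summable (\<lambda>n. \<integral>x. norm (f n x) \<partial>lborel)"
    by (rule summable_comparison_test[OF _ summable_geometric[of "cmod z"]])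
       (use assms bn_le in \<open>auto simp: bn\<close>)
  have i: "integrable lborel (f n)" for n using b by (rule integrable.intros)
  have eq: "(\<lambda>x. \<Sum>n. f n x) = (\<lambda>x. of_real (std_normal_density x) * exp (z * of_real (x\<^sup>2) / 2))"
    using pt by (auto simp: sums_iff)
  have int: "integrable lborel (\<lambda>x. of_real (std_normal_density x) * exp (z * of_real (x\<^sup>2) / 2))"
    unfolding eq[symmetric] by (rule integrable_suminf[OF i _ s]) (use ns in auto)
  have "(\<lambda>n. integral\<^sup>L lborel (f n)) sums (\<integral>x. (\<Sum>n. f n x) \<partial>lborel)"
    by (rule sums_integral[OF i _ s]) (use ns in auto)
  then have 1: "(\<lambda>n. ?c n * of_real (fact (2 * n) / (2 ^ n * fact n))) sums
      (\<integral>x. of_real (std_normal_density x) * exp (z * of_real (x\<^sup>2) / 2) \<partial>lborel)"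
    unfolding eq using b[THEN has_bochner_integral_integral_eq] by simp
  have "(\<lambda>n. (- (1 / 2) gchoose n) * (- z) ^ n) sums (1 + - z) powr (- (1 / 2))"
    using assms by (intro gen_binomial_complex) auto
  moreover have "(- (1 / 2) gchoose n) * (- z) ^ n = ?c n * of_real (fact (2 * n) / (2 ^ n * fact n))" for n
  proof -
    have "(- (1 / 2) gchoose n) * (- z) ^ n = z ^ n * ((- (1 / 2) gchoose n) * (- 1) ^ n)"
      by (simp add: power_minus[of z])
    then show ?thesis unfolding gbinomial_minus_half by simp
  qed
  ultimately have 2: "(\<lambda>n. ?c n * of_real (fact (2 * n) / (2 ^ n * fact n))) sums
      (1 - z) powr (- (1 / 2))" by simp
  have "1 - z \<notin> \<real>\<^sub>\<le>\<^sub>0"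
    using assms complex_Re_le_cmod[of z] by (auto simp: complex_nonpos_Reals_iff)
  then have "(1 - z) powr (- (1 / 2)) = csqrt (1 / (1 - z))"
    by (simp only: powr_minus csqrt_conv_powr[symmetric] csqrt_inverse[symmetric] not_False_eq_True)
       (simp only: inverse_eq_divide)
  with sums_unique2[OF 1 2] int show ?thesis by (simp add: has_bochner_integral_iff)
qed

lemma csqrt_of_real_mult:
  assumes "a > 0"
  shows "csqrt (of_real a * w) = of_real (sqrt a) * csqrt w"
  using assms csqrt_principal[of w]
  by (intro csqrt_unique) (auto simp: power_mult_distrib zero_less_mult_iff simp del: csqrt.simps simp flip: of_real_power)

text \<open>Every \<open>w\<close> in the right half-plane has a positive multiple in the disc of radius 1 about 1, so a
  rescaling of the variable reduces the integral to the preceding lemma.\<close>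

lemma complex_gaussian_integral:
  assumes "Re w > 0"
  shows "has_bochner_integral lborel (\<lambda>x. exp (- w * of_real (x\<^sup>2) / 2)) (of_real (sqrt (2 * pi)) * csqrt (1 / w))"
proof -
  \<comment> \<open>The multiple of \<open>w\<close> closest to 1.\<close>
  define l where "l = Re w / (cmod w)\<^sup>2"
  have w: "cmod w > 0" using assms by auto
  have l: "l > 0" using assms w by (auto simp: l_def)
  define z where "z = 1 - of_real l * w"
  have "(cmod z)\<^sup>2 = 1 - 2 * l * Re w + l\<^sup>2 * (cmod w)\<^sup>2"
    unfolding cmod_power2 by (simp add: z_def power2_eq_square algebra_simps)
  also have "l\<^sup>2 * (cmod w)\<^sup>2 = l * Re w"
    using w by (simp add: l_def power2_eq_square)
  also have "1 - 2 * l * Re w + l * Re w < 1" using l assms by simp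
  finally have "cmod z < 1" by (metis norm_ge_zero power2_less_imp_less one_power2 zero_le_one)
  from gaussian_expectation_exp_square_disc[OF this]
  have "has_bochner_integral lborel
      (\<lambda>x. of_real (sqrt (2 * pi)) * (of_real (std_normal_density x) * exp (z * of_real (x\<^sup>2) / 2)))
      (of_real (sqrt (2 * pi)) * csqrt (1 / (1 - z)))"
    by (rule has_bochner_integral_mult_right)
  also have "(\<lambda>x. of_real (sqrt (2 * pi)) * (of_real (std_normal_density x) * exp (z * of_real (x\<^sup>2) / 2))) =
      (\<lambda>x. exp (- (of_real l * w) * of_real (x\<^sup>2) / 2))"
  proof
    fix x :: real
    have "of_real (sqrt (2 * pi)) * of_real (std_normal_density x) = exp (of_real (- x\<^sup>2 / 2) :: complex)"
      by (simp add: std_normal_density_def exp_of_real[symmetric] del: of_real_power)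
    then have "of_real (sqrt (2 * pi)) * (of_real (std_normal_density x) * exp (z * of_real (x\<^sup>2) / 2)) = 
      exp (of_real (- x\<^sup>2 / 2)) * exp (z * of_real (x\<^sup>2) / 2)" by (simp only: mult.assoc[symmetric])
    also have "\<dots> = exp (- (of_real l * w) * of_real (x\<^sup>2) / 2)"
      unfolding exp_add[symmetric] by (rule arg_cong[where f=exp]) (simp add: z_def field_simps)
    finally show "of_real (sqrt (2 * pi)) * (of_real (std_normal_density x) * exp (z * of_real (x\<^sup>2) / 2)) = 
      exp (- (of_real l * w) * of_real (x\<^sup>2) / 2)" .
  qed
  finally have "has_bochner_integral lborel (\<lambda>x. exp (- (of_real l * w) * of_real (x\<^sup>2) / 2))
      (of_real (sqrt (2 * pi)) * csqrt (1 / (1 - z)))" .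
  from lborel_has_bochner_integral_real_affine_iff[THEN iffD1, OF _ this, of "1 / sqrt l" 0]
  have "has_bochner_integral lborel (\<lambda>x. exp (- w * of_real (x\<^sup>2) / 2))
      ((of_real (sqrt (2 * pi)) * csqrt (1 / (1 - z))) /\<^sub>R \<bar>1 / sqrt l\<bar>)"
    using l by (simp add: power_divide)
  moreover have "csqrt (1 / (1 - z)) = of_real (sqrt (1 / l)) * csqrt (1 / w)"
    using l csqrt_of_real_mult[of "1 / l" "1 / w"] by (simp add: z_def)
  ultimately show ?thesis using l by (simp add: scaleR_conv_of_real real_sqrt_divide)
qed

text \<open>Since the linear coefficient \<open>w * t\<close> is a real multiple of \<open>w\<close>, the square is completed by a real
  translation and no contour has to be moved.\<close>

lemma complex_gaussian_integral_shifted: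
  assumes "Re w > 0"
  shows "has_bochner_integral lborel (\<lambda>x. exp (- w * of_real (x\<^sup>2) / 2) * exp (w * of_real x * of_real t))
     (of_real (sqrt (2 * pi)) * csqrt (1 / w) * exp (w * of_real (t\<^sup>2) / 2))"
proof -
  have "has_bochner_integral lborel (\<lambda>x. exp (- w * of_real ((- t + 1 * x)\<^sup>2) / 2)) ((of_real (sqrt (2 * pi)) * csqrt (1 / w)) /\<^sub>R \<bar>1\<bar>)"
    by (rule lborel_has_bochner_integral_real_affine_iff[THEN iffD1, OF _ complex_gaussian_integral[OF assms]]) simp
  then have "has_bochner_integral lborel (\<lambda>x. exp (- w * of_real ((- t + 1 * x)\<^sup>2) / 2) * exp (w * of_real (t\<^sup>2) / 2)) 
     ((of_real (sqrt (2 * pi)) * csqrt (1 / w)) /\<^sub>R \<bar>1\<bar> * exp (w * of_real (t\<^sup>2) / 2))"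
    by (rule has_bochner_integral_mult_left)
  moreover have "exp (- w * of_real ((- t + 1 * x)\<^sup>2) / 2) * exp (w * of_real (t\<^sup>2) / 2) =
     exp (- w * of_real (x\<^sup>2) / 2) * exp (w * of_real x * of_real t)" for x
    unfolding exp_add[symmetric] by (rule arg_cong[where f=exp]) (simp add: power2_eq_square field_simps)
  ultimately show ?thesis by simp
qed

section \<open>The limit of powers of the hyperbolic cosine\<close>

text \<open>For imaginary \<open>w\<close> this is the convergence of characteristic functions behind the central limit
  theorem for \<open>S / sqrt N\<close>.\<close>

lemma tendsto_cosh_power:
  fixes w :: complex
  shows "(\<lambda>n. cosh (w / of_real (sqrt (real n))) ^ n) \<longlonglongrightarrow> exp (w\<^sup>2 / 2)"
proof -
  \<comment> \<open>The difference quotients \<open>r\<close> of \<open>sinh\<close> and \<open>q\<close> of \<open>Ln (1 + u)\<close> at 0 replace Taylor estimates, and they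
    remain usable where the argument vanishes.\<close>
  have "((sinh :: complex \<Rightarrow> complex) has_field_derivative 1) (at 0)"
    by (auto intro!: derivative_eq_intros)
  then obtain r :: "complex \<Rightarrow> complex" where r: "\<And>z. sinh z = r z * z" "isCont r 0" "r 0 = 1"
    by (auto simp: CARAT_DERIV)
  have "((\<lambda>u::complex. Ln (1 + u)) has_field_derivative 1) (at 0)"
    by (auto intro!: derivative_eq_intros)
  then obtain q where q: "\<And>u. Ln (1 + u) = q u * u" "isCont q 0" "q 0 = 1"
    by (auto simp: CARAT_DERIV)
  define h where "h n = w / (2 * of_real (sqrt (real n)))" for n
  define u where "u n = 2 * (sinh (h n))\<^sup>2" for n
  have cosh: "cosh (w / of_real (sqrt (real n))) = 1 + u n" for n
    using cosh_double[of "h n"] by (simp add: h_def u_def cosh_square_eq mult.commute)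
  have "(\<lambda>n. 1 / sqrt (real n)) \<longlonglongrightarrow> 0"
    by (intro tendsto_divide_0[OF tendsto_const] filterlim_at_top_imp_at_infinity
          filterlim_compose[OF sqrt_at_top filterlim_real_sequentially])
  then have "(\<lambda>n. w / 2 * of_real (1 / sqrt (real n))) \<longlonglongrightarrow> w / 2 * of_real 0"
    by (intro tendsto_intros)
  then have h0: "h \<longlonglongrightarrow> 0" by (simp add: h_def[abs_def])
  have rh: "(\<lambda>n. r (h n)) \<longlonglongrightarrow> 1"
    using isCont_tendsto_compose[OF r(2) h0] r(3) by simp
  have "(\<lambda>n. 2 * (r (h n) * h n)\<^sup>2) \<longlonglongrightarrow> 2 * (1 * 0)\<^sup>2"
    by (intro tendsto_intros rh h0)
  then have u0: "u \<longlonglongrightarrow> 0" by (simp add: u_def[abs_def] r(1))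
  have qu: "(\<lambda>n. q (u n)) \<longlonglongrightarrow> 1"
    using isCont_tendsto_compose[OF q(2) u0] q(3) by simp
  have nu: "of_nat n * u n = w\<^sup>2 / 2 * (r (h n))\<^sup>2" if "n > 0" for n
    using that by (simp add: u_def r(1) h_def power_mult_distrib power_divide field_simps flip: of_real_power)
  have "(\<lambda>n. exp (w\<^sup>2 / 2 * (r (h n))\<^sup>2 * q (u n))) \<longlonglongrightarrow> exp (w\<^sup>2 / 2 * 1\<^sup>2 * 1)"
    by (intro tendsto_intros rh qu)
  then have L: "(\<lambda>n. exp (w\<^sup>2 / 2 * (r (h n))\<^sup>2 * q (u n))) \<longlonglongrightarrow> exp (w\<^sup>2 / 2)" by simp
  have "\<forall>\<^sub>F n in sequentially. u n \<noteq> -1"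
    using u0 by (rule tendsto_imp_eventually_ne) auto
  then have "\<forall>\<^sub>F n in sequentially. exp (w\<^sup>2 / 2 * (r (h n))\<^sup>2 * q (u n)) =
      cosh (w / of_real (sqrt (real n))) ^ n"
    using eventually_gt_at_top[of 0]
  proof eventually_elim
    case (elim n)
    have "1 + u n \<noteq> 0" using elim(1) by (metis add_eq_0_iff)
    have "w\<^sup>2 / 2 * (r (h n))\<^sup>2 * q (u n) = of_nat n * (q (u n) * u n)"
      using nu[OF elim(2)] by (simp add: algebra_simps)
    also have "\<dots> = of_nat n * Ln (1 + u n)" by (simp add: q(1))
    finally have "exp (w\<^sup>2 / 2 * (r (h n))\<^sup>2 * q (u n)) = exp (Ln (1 + u n)) ^ n"
      by (simp only: exp_of_nat_mult)
    then show ?case using \<open>1 + u n \<noteq> 0\<close> by (simp add: cosh)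
  qed
  then show ?thesis using L by (rule Lim_transform_eventually[rotated])
qed

section \<open>Spin sums and the Hubbard-Stratonovich identity\<close>

lemma finite_spins: "finite (spins N)"
  by (auto simp: spins_def intro!: finite_PiE)

lemma card_spins: "card (spins N) = 2 ^ N"
  by (simp add: spins_def card_PiE numeral_2_eq_2)

lemma spins_exp_sum:
  fixes w :: complex
  shows "(\<Sum>\<sigma>\<in>spins N. exp (w * of_real (\<Sum>i=1..N. \<sigma> i))) = 2 ^ N * cosh w ^ N"
proof -
  have exp_sum_eq: "exp (- w) + exp w = 2 * cosh w"
    by (simp add: cosh_def scaleR_conv_of_real)
  have "(\<Sum>\<sigma>\<in>spins N. exp (w * of_real (\<Sum>i=1..N. \<sigma> i))) =
      (\<Sum>\<sigma>\<in>spins N. \<Prod>i=1..N. exp (w * of_real (\<sigma> i)))"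
    by (simp add: exp_sum sum_distrib_left)
  also have "\<dots> = (\<Prod>i=1..N. \<Sum>s\<in>{-1, 1}. exp (w * of_real s))"
    unfolding spins_def by (rule prod_sum_PiE[symmetric]) auto
  also have "\<dots> = (2 * cosh w) ^ N" by (simp add: exp_sum_eq)
  finally show ?thesis by (simp add: power_mult_distrib)
qed

lemma cw_energy_eq: "cw_energy N \<sigma> = - ((\<Sum>i=1..N. \<sigma> i) / sqrt (real N))\<^sup>2 / 2"
  by (simp add: cw_energy_def power_divide power2_eq_square sum_product)

lemma cw_partition_eq:
  "cw_partition \<beta> N =
     (\<Sum>\<sigma>\<in>spins N. exp (\<beta> * of_real (((\<Sum>i=1..N. \<sigma> i) / sqrt (real N))\<^sup>2) / 2)) / 2 ^ N"
  by (simp add: cw_partition_def cw_energy_eq)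

text \<open>The identity holds for \<open>N = 0\<close> as well: both sides are then a plain Gaussian integral.\<close>

lemma hubbard_stratonovich:
  assumes "Re \<beta> > 0"
  shows "has_bochner_integral lborel
      (\<lambda>s. exp (- \<beta> * of_real (s\<^sup>2) / 2) * cosh (\<beta> * of_real s / of_real (sqrt (real N))) ^ N)
      (of_real (sqrt (2 * pi)) * csqrt (1 / \<beta>) * cw_partition \<beta> N)"
proof -
  let ?t = "\<lambda>\<sigma>. (\<Sum>i=1..N. \<sigma> i) / sqrt (real N)"
  let ?f = "\<lambda>s \<sigma>. exp (- \<beta> * of_real (s\<^sup>2) / 2) * exp (\<beta> * of_real s * of_real (?t \<sigma>))"
  have "has_bochner_integral lborel (\<lambda>s. (\<Sum>\<sigma>\<in>spins N. ?f s \<sigma>) / 2 ^ N)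
     ((\<Sum>\<sigma>\<in>spins N. of_real (sqrt (2 * pi)) * csqrt (1 / \<beta>) * exp (\<beta> * of_real ((?t \<sigma>)\<^sup>2) / 2)) / 2 ^ N)"
    using assms
    by (intro has_bochner_integral_divide has_bochner_integral_sum complex_gaussian_integral_shifted) auto
  also have "(\<lambda>s. (\<Sum>\<sigma>\<in>spins N. ?f s \<sigma>) / 2 ^ N) =
     (\<lambda>s. exp (- \<beta> * of_real (s\<^sup>2) / 2) * cosh (\<beta> * of_real s / of_real (sqrt (real N))) ^ N)"
  proof
    fix s :: real
    have "(\<Sum>\<sigma>\<in>spins N. ?f s \<sigma>) = exp (- \<beta> * of_real (s\<^sup>2) / 2) *
        (\<Sum>\<sigma>\<in>spins N. exp (\<beta> * of_real s / of_real (sqrt (real N)) * of_real (\<Sum>i=1..N. \<sigma> i)))"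
      by (subst sum_distrib_left) (simp del: of_real_sum)
    then show "(\<Sum>\<sigma>\<in>spins N. ?f s \<sigma>) / 2 ^ N =
        exp (- \<beta> * of_real (s\<^sup>2) / 2) * cosh (\<beta> * of_real s / of_real (sqrt (real N))) ^ N"
      by (simp only: spins_exp_sum) simp
  qed
  also have "(\<Sum>\<sigma>\<in>spins N. of_real (sqrt (2 * pi)) * csqrt (1 / \<beta>) * exp (\<beta> * of_real ((?t \<sigma>)\<^sup>2) / 2)) / 2 ^ N =
      of_real (sqrt (2 * pi)) * csqrt (1 / \<beta>) * cw_partition \<beta> N"
    by (simp add: cw_partition_eq sum_distrib_left)
  finally show ?thesis .
qed

section \<open>Convergence under Gaussian decay of the integrand\<close>

lemma Re_divide_pos:
  assumes "\<bar>Im x\<bar> < Re x" "\<bar>Im y\<bar> < Re y"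
  shows "Re (x / y) > 0"
proof -
  have "\<bar>Im x * Im y\<bar> < Re x * Re y"
    unfolding abs_mult by (rule mult_strict_mono') (use assms in auto)
  then have "Re x * Re y + Im x * Im y > 0" by linarith
  moreover have "(Re y)\<^sup>2 + (Im y)\<^sup>2 > 0" using assms by (simp add: sum_power2_gt_zero_iff)
  ultimately show ?thesis by (simp add: Re_divide)
qed

text \<open>Roots of numbers in the right half-plane have an argument of absolute value below \<open>pi / 4\<close>, so
  their quotient is still in the right half-plane.\<close>

lemma csqrt_divide_right_half_plane:
  assumes "Re a > 0" "Re b > 0"
  shows "csqrt (a / b) = csqrt a / csqrt b"
proof -
  have "\<bar>Im (csqrt z)\<bar> < Re (csqrt z)" if "Re z > 0" for z
  proof (rule power2_less_imp_less[OF _ Re_csqrt])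
    have "(Re (csqrt z))\<^sup>2 - (Im (csqrt z))\<^sup>2 = Re z"
      by (metis power2_csqrt Re_power2)
    then show "\<bar>Im (csqrt z)\<bar>\<^sup>2 < (Re (csqrt z))\<^sup>2" using that unfolding power2_abs by linarith
  qed
  then have "Re (csqrt a / csqrt b) > 0"
    using assms by (intro Re_divide_pos)
  moreover have "(csqrt a / csqrt b)\<^sup>2 = a / b"
    by (simp only: power_divide power2_csqrt)
  ultimately show ?thesis by (intro csqrt_unique disjI1)
qed

lemma cw_partition_tendsto_if_gaussian_decay:
  assumes pos: "Re \<beta> > 0" and k: "k > 0"
    and decay: "\<And>m::real. cmod (exp (- \<beta> * of_real (m\<^sup>2) / 2) * cosh (\<beta> * of_real m)) \<le> exp (- k * m\<^sup>2)"
  shows "cw_partition \<beta> \<longlonglongrightarrow> csqrt (cw_ratio \<beta>)"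
proof -
  \<comment> \<open>The integrand \<open>?F\<close> and its limit \<open>?L\<close> in the scaled variable \<open>s = sqrt N * m\<close>.\<close>
  let ?g = "\<lambda>m::real. exp (- \<beta> * of_real (m\<^sup>2) / 2) * cosh (\<beta> * of_real m)"
  let ?F = "\<lambda>N s. exp (- \<beta> * of_real (s\<^sup>2) / 2) * cosh (\<beta> * of_real s / of_real (sqrt (real N))) ^ N"
  let ?L = "\<lambda>s::real. exp (- (\<beta> - \<beta>\<^sup>2) * of_real (s\<^sup>2) / 2)"
  have \<beta>: "\<beta> \<noteq> 0" using pos by auto
  have lim: "(\<lambda>N. ?F N s) \<longlonglongrightarrow> ?L s" for s
  proof -
    have "(\<lambda>N. ?F N s) \<longlonglongrightarrow> exp (- \<beta> * of_real (s\<^sup>2) / 2) * exp ((\<beta> * of_real s)\<^sup>2 / 2)"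
      by (intro tendsto_mult tendsto_const tendsto_cosh_power)
    also have "exp (- \<beta> * of_real (s\<^sup>2) / 2) * exp ((\<beta> * of_real s)\<^sup>2 / 2) = ?L s"
      unfolding exp_add[symmetric] by (rule arg_cong[where f=exp]) (simp add: field_simps power_mult_distrib)
    finally show ?thesis .
  qed
  have bound: "cmod (?F (Suc n) s) \<le> exp (- k * s\<^sup>2)" for n s
  proof -
    let ?N = "Suc n"
    let ?m = "s / sqrt (real ?N)"
    have N: "real ?N * ?m\<^sup>2 = s\<^sup>2" by (simp add: power_divide)
    have "exp (- \<beta> * of_real (s\<^sup>2) / 2) = exp (- \<beta> * of_real (?m\<^sup>2) / 2) ^ ?N"
      unfolding exp_of_nat_mult[symmetric] N[symmetric] by (rule arg_cong[where f=exp]) simp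
    then have "?F ?N s = ?g ?m ^ ?N"
      by (simp only: power_mult_distrib) simp
    then have "cmod (?F ?N s) = cmod (?g ?m) ^ ?N" by (simp only: norm_power)
    also have "\<dots> \<le> exp (- k * ?m\<^sup>2) ^ ?N" by (intro power_mono decay norm_ge_zero)
    also have "\<dots> = exp (real ?N * (- k * ?m\<^sup>2))" by (simp only: exp_of_nat_mult)
    also have "real ?N * (- k * ?m\<^sup>2) = - k * (real ?N * ?m\<^sup>2)" by (simp only: mult_ac)
    finally show ?thesis unfolding N .
  qed
  \<comment> \<open>The bound passes to the limit, so the limiting Gaussian is integrable without a separate
    condition on \<open>\<beta>\<close>.\<close>
  have Re_pos: "Re (\<beta> - \<beta>\<^sup>2) > 0"
  proof -
    have "(\<lambda>n. cmod (?F (Suc n) 1)) \<longlonglongrightarrow> cmod (?L 1)"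
      by (intro tendsto_norm LIMSEQ_Suc[OF lim])
    then have "cmod (?L 1) \<le> exp (- k * 1\<^sup>2)"
      by (rule LIMSEQ_le_const2) (intro exI allI impI bound)
    then show ?thesis using k by simp
  qed
  have intk: "integrable lborel (\<lambda>s. exp (- k * s\<^sup>2))"
  proof -
    have "Re (of_real (2 * k)) > 0" using k by simp
    from complex_gaussian_integral[OF this]
    have "integrable lborel (\<lambda>x. exp (- complex_of_real (2 * k) * of_real (x\<^sup>2) / 2))"
      by (rule integrable.intros)
    from integrable_norm[OF this] show ?thesis by simp
  qed
  \<comment> \<open>The index starts at 1, since \<open>m = s / sqrt N\<close> degenerates for \<open>N = 0\<close>.\<close>
  have "(\<lambda>n. \<integral>s. ?F (Suc n) s \<partial>lborel) \<longlonglongrightarrow> (\<integral>s. ?L s \<partial>lborel)"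
  proof (rule integral_dominated_convergence[OF _ _ intk])
    show "?F (Suc n) \<in> borel_measurable lborel" for n
      using integrable.intros[OF hubbard_stratonovich[OF pos, of "Suc n"]]
      by (rule borel_measurable_integrable)
    show "?L \<in> borel_measurable lborel"
      using complex_gaussian_integral[OF Re_pos] by (rule borel_measurable_has_bochner_integral)
    show "AE s in lborel. (\<lambda>n. ?F (Suc n) s) \<longlonglongrightarrow> ?L s"
      using LIMSEQ_Suc[OF lim] by auto
  qed (use bound in auto)
  then have *: "(\<lambda>n. of_real (sqrt (2 * pi)) * csqrt (1 / \<beta>) * cw_partition \<beta> (Suc n)) \<longlonglongrightarrow>
      of_real (sqrt (2 * pi)) * csqrt (1 / (\<beta> - \<beta>\<^sup>2))"
    unfolding has_bochner_integral_integral_eq[OF hubbard_stratonovich[OF pos]]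
      has_bochner_integral_integral_eq[OF complex_gaussian_integral[OF Re_pos]] .
  have "(\<lambda>n. cw_partition \<beta> (Suc n)) \<longlonglongrightarrow> csqrt (1 / (\<beta> - \<beta>\<^sup>2)) / csqrt (1 / \<beta>)"
    using tendsto_divide[OF * tendsto_const[of "of_real (sqrt (2 * pi)) * csqrt (1 / \<beta>)"]] \<beta> by simp
  moreover have "Re (1 / z) > 0" if "Re z > 0" for z :: complex
    using that by (auto simp: Re_divide intro!: divide_pos_pos simp: sum_power2_gt_zero_iff)
  then have "csqrt (1 / (\<beta> - \<beta>\<^sup>2)) / csqrt (1 / \<beta>) = csqrt (cw_ratio \<beta>)"
    using csqrt_divide_right_half_plane[of "1 / (\<beta> - \<beta>\<^sup>2)" "1 / \<beta>"] pos Re_pos \<beta>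
    by (simp add: cw_ratio_def)
  ultimately show ?thesis by (simp add: filterlim_sequentially_Suc)
qed

section \<open>Convergence for nonpositive real part\<close>

lemma cw_partition_tendsto_nonpos:
  assumes "Re \<beta> \<le> 0"
  shows "cw_partition \<beta> \<longlonglongrightarrow> csqrt (cw_ratio \<beta>)"
proof -
  let ?t = "\<lambda>N \<sigma>. (\<Sum>i=1..N. \<sigma> i) / sqrt (real N)"
  \<comment> \<open>The law of \<open>S / sqrt N\<close> under uniformly distributed spins.\<close>
  define M where "M N = distr (measure_pmf (pmf_of_set (spins N))) borel (?t N)" for N
  have ne: "spins N \<noteq> {}" for N using card_spins[of N] by auto
  have dist: "real_distribution (M N)" for N
    unfolding M_def by (intro prob_space.real_distribution_distr measure_pmf.prob_space_axioms) auto
  have int: "(\<integral>x. f x \<partial>M N) = (\<Sum>\<sigma>\<in>spins N. f (?t N \<sigma>)) / 2 ^ N"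
    if "f \<in> borel_measurable borel" for f :: "real \<Rightarrow> complex" and N
  proof -
    have "(\<integral>x. f x \<partial>M N) = (\<integral>\<sigma>. f (?t N \<sigma>) \<partial>measure_pmf (pmf_of_set (spins N)))"
      using that unfolding M_def by (intro integral_distr) auto
    also have "\<dots> = (\<Sum>\<sigma>\<in>spins N. pmf (pmf_of_set (spins N)) \<sigma> *\<^sub>R f (?t N \<sigma>))"
      by (rule integral_measure_pmf[OF finite_spins]) (simp add: set_pmf_of_set[OF ne finite_spins])
    also have "\<dots> = (\<Sum>\<sigma>\<in>spins N. f (?t N \<sigma>) / 2 ^ N)"
      by (intro sum.cong refl)
         (simp add: pmf_of_set[OF ne finite_spins] card_spins scaleR_conv_of_real)
    finally show ?thesis by (simp only: sum_divide_distrib)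
  qed
  have "weak_conv_m M std_normal_distribution"
  proof (rule levy_continuity[OF dist real_dist_normal_dist])
    fix t :: real
    have "char (M N) t = cosh (\<i> * of_real t / of_real (sqrt (real N))) ^ N" for N
    proof -
      have "char (M N) t = (\<Sum>\<sigma>\<in>spins N. exp (\<i> * of_real t / of_real (sqrt (real N)) * of_real (\<Sum>i=1..N. \<sigma> i))) / 2 ^ N"
        unfolding char_def by (subst int) (simp_all add: mult.assoc del: of_real_sum)
      then show ?thesis by (simp only: spins_exp_sum) simp
    qed
    then show "(\<lambda>N. char (M N) t) \<longlonglongrightarrow> char std_normal_distribution t"
      using tendsto_cosh_power[of "\<i> * of_real t"]
      by (simp add: char_std_normal_distribution power_mult_distrib exp_of_real[symmetric])
  qed
  moreover have "cmod (exp (\<beta> * of_real (x\<^sup>2) / 2)) \<le> 1" for x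
    using assms by (simp add: mult_nonpos_nonneg)
  ultimately have "(\<lambda>N. \<integral>x. exp (\<beta> * of_real (x\<^sup>2) / 2) \<partial>M N) \<longlonglongrightarrow>
      (\<integral>x. exp (\<beta> * of_real (x\<^sup>2) / 2) \<partial>std_normal_distribution)"
    by (intro weak_conv_imp_integral_bdd_continuous_conv[OF dist real_dist_normal_dist, where B=1]) auto
  also have "(\<lambda>N. \<integral>x. exp (\<beta> * of_real (x\<^sup>2) / 2) \<partial>M N) = cw_partition \<beta>"
    by (rule ext, subst int) (simp_all add: cw_partition_eq)
  also have "(\<integral>x. exp (\<beta> * of_real (x\<^sup>2) / 2) \<partial>std_normal_distribution) =
      (\<integral>x. exp (- (1 - \<beta>) * of_real (x\<^sup>2) / 2) / of_real (sqrt (2 * pi)) \<partial>lborel)"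
  proof (subst integral_density)
    show "(\<integral>x. std_normal_density x *\<^sub>R exp (\<beta> * of_real (x\<^sup>2) / 2) \<partial>lborel) =
      (\<integral>x. exp (- (1 - \<beta>) * of_real (x\<^sup>2) / 2) / of_real (sqrt (2 * pi)) \<partial>lborel)"
    proof (rule Bochner_Integration.integral_cong[OF refl])
      fix x :: real
      have "exp (- (1 - \<beta>) * of_real (x\<^sup>2) / 2) = exp (of_real (- x\<^sup>2 / 2)) * exp (\<beta> * of_real (x\<^sup>2) / 2)"
        unfolding exp_add[symmetric] by (rule arg_cong[where f=exp]) (simp add: field_simps)
      then show "std_normal_density x *\<^sub>R exp (\<beta> * of_real (x\<^sup>2) / 2) =
          exp (- (1 - \<beta>) * of_real (x\<^sup>2) / 2) / of_real (sqrt (2 * pi))"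
        by (simp add: std_normal_density_def scaleR_conv_of_real exp_of_real[symmetric])
    qed
  qed auto
  also have "\<dots> = csqrt (1 / (1 - \<beta>))"
    using assms has_bochner_integral_integral_eq[OF complex_gaussian_integral[of "1 - \<beta>"]] by simp
  also have "1 / (1 - \<beta>) = cw_ratio \<beta>"
  proof -
    have "\<beta> - \<beta>\<^sup>2 = \<beta> * (1 - \<beta>)" by (simp add: power2_eq_square algebra_simps)
    then show ?thesis by (simp add: cw_ratio_def)
  qed
  finally show ?thesis .
qed

section \<open>Gaussian decay of the integrand\<close>

lemma norm_integrand_squared:
  fixes m :: real
  shows "(cmod (exp (- \<beta> * of_real (m\<^sup>2) / 2) * cosh (\<beta> * of_real m)))\<^sup>2 =
    exp (- Re \<beta> * m\<^sup>2) * ((cosh (Re \<beta> * m))\<^sup>2 - (sin (Im \<beta> * m))\<^sup>2)"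
proof -
  have "(cmod (exp (- \<beta> * of_real (m\<^sup>2) / 2)))\<^sup>2 = exp (- Re \<beta> * m\<^sup>2)"
    by (simp flip: exp_double)
  then show ?thesis by (simp add: norm_mult power_mult_distrib norm_cosh_squared)
qed

lemma norm_integrand_le_if_squared:
  fixes m :: real
  assumes "exp (- Re \<beta> * m\<^sup>2) * ((cosh (Re \<beta> * m))\<^sup>2 - (sin (Im \<beta> * m))\<^sup>2) \<le> exp (- (2 * k) * m\<^sup>2)"
  shows "cmod (exp (- \<beta> * of_real (m\<^sup>2) / 2) * cosh (\<beta> * of_real m)) \<le> exp (- k * m\<^sup>2)"
proof (rule power2_le_imp_le)
  have "(exp (- k * m\<^sup>2))\<^sup>2 = exp (- (2 * k) * m\<^sup>2)"
    by (simp flip: exp_double)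
  then show "(cmod (exp (- \<beta> * of_real (m\<^sup>2) / 2) * cosh (\<beta> * of_real m)))\<^sup>2 \<le> (exp (- k * m\<^sup>2))\<^sup>2"
    using assms by (simp only: norm_integrand_squared)
qed simp

lemma cosh_squared_le: "(cosh (x::real))\<^sup>2 \<le> exp (x\<^sup>2)"
proof -
  have "(cosh x)\<^sup>2 \<le> (exp (x\<^sup>2 / 2))\<^sup>2"
    by (intro power_mono cosh_le_exp_half_square) auto
  then show ?thesis by (simp flip: exp_double)
qed

lemma decay_subcritical:
  fixes m :: real
  shows "cmod (exp (- \<beta> * of_real (m\<^sup>2) / 2) * cosh (\<beta> * of_real m))
     \<le> exp (- (Re \<beta> * (1 - Re \<beta>) / 2) * m\<^sup>2)"
proof (rule norm_integrand_le_if_squared)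
  have "exp (- Re \<beta> * m\<^sup>2) * ((cosh (Re \<beta> * m))\<^sup>2 - (sin (Im \<beta> * m))\<^sup>2)
     \<le> exp (- Re \<beta> * m\<^sup>2) * exp ((Re \<beta> * m)\<^sup>2)"
    using cosh_squared_le[of "Re \<beta> * m"] by (intro mult_left_mono) (auto intro: order_trans[rotated])
  also have "\<dots> = exp (- (2 * (Re \<beta> * (1 - Re \<beta>) / 2)) * m\<^sup>2)"
    unfolding exp_add[symmetric] by (simp add: field_simps power2_eq_square)
  finally show "exp (- Re \<beta> * m\<^sup>2) * ((cosh (Re \<beta> * m))\<^sup>2 - (sin (Im \<beta> * m))\<^sup>2)
     \<le> exp (- (2 * (Re \<beta> * (1 - Re \<beta>) / 2)) * m\<^sup>2)" .
qed

text \<open>The three cases of the proof are: \<open>m\<^sup>2\<close> of order at most \<open>\<epsilon>\<close>, where the sine compensates the growth;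
  \<open>\<bar>m\<bar> \<le> 4\<close> beyond that, where the fourth-order deficit of the hyperbolic cosine does; and
  \<open>\<bar>m\<bar> > 4\<close>, where \<open>cosh y \<le> exp \<bar>y\<bar>\<close> suffices. The constant \<open>\<delta>\<close> is a lower bound for the coefficient of that
  deficit on \<open>\<bar>y\<bar> \<le> 6\<close>, the range of \<open>y = Re \<beta> * m\<close> in the middle case.\<close>

lemma decay_supercritical:
  fixes \<epsilon> R m \<delta> :: real
  defines "\<delta> \<equiv> exp (- 18) / 12"
  assumes \<epsilon>: "0 < \<epsilon>" "\<epsilon> \<le> \<delta> / 2"
    and R: "4 * exp 2 * sqrt \<epsilon> \<le> R" "R \<le> sqrt (\<delta> / 2) / sqrt \<epsilon>"
    and \<beta>: "\<beta> = 1 + of_real \<epsilon> + \<i> * of_real R"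
  shows "cmod (exp (- \<beta> * of_real (m\<^sup>2) / 2) * cosh (\<beta> * of_real m)) \<le> exp (- (\<epsilon> / 2) * m\<^sup>2)"
proof (rule norm_integrand_le_if_squared)
  have "exp (- 18) \<le> exp (0 :: real)" by (subst exp_le_cancel_iff) simp
  then have \<delta>: "\<delta> > 0" "\<delta> \<le> 1"
    unfolding \<delta>_def exp_zero by (simp, linarith)
  define \<alpha> where "\<alpha> = 1 + \<epsilon>"
  define y where "y = \<alpha> * m"
  have \<alpha>: "1 \<le> \<alpha>" "\<alpha> \<le> 3 / 2" using \<epsilon> \<delta> by (auto simp: \<alpha>_def)
  have R0: "R > 0" using R(1) \<epsilon>(1) by (smt (verit) exp_gt_zero mult_pos_pos real_sqrt_gt_zero)
  have y2: "y\<^sup>2 = \<alpha> * m\<^sup>2 + \<alpha> * \<epsilon> * m\<^sup>2"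
    by (simp add: y_def \<alpha>_def power2_eq_square algebra_simps)
  have \<alpha>\<epsilon>: "\<alpha> * \<epsilon> * m\<^sup>2 \<le> 3 / 2 * \<epsilon> * m\<^sup>2" using \<alpha> \<epsilon> by (intro mult_right_mono) auto
  have goal: "exp (- \<alpha> * m\<^sup>2) * ((cosh y)\<^sup>2 - (sin (R * m))\<^sup>2) \<le> exp (- \<epsilon> * m\<^sup>2)"
  proof -
    consider (near) "m\<^sup>2 \<le> 2 * \<epsilon> / \<delta>" | (middle) "2 * \<epsilon> / \<delta> < m\<^sup>2" "\<bar>m\<bar> \<le> 4" | (far) "4 < \<bar>m\<bar>"
      by linarith
    then show ?thesis
    proof cases
      case near
      \<comment> \<open>The upper bound on \<open>R\<close> keeps \<open>R * m\<close> in \<open>[-1, 1]\<close>; the lower bound makes the sine large enough.\<close>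
      have "2 * \<epsilon> / \<delta> \<le> 1" using \<epsilon> \<delta> by (simp add: divide_le_eq)
      then have m1: "m\<^sup>2 \<le> 1" using near by linarith
      have "R\<^sup>2 \<le> (sqrt (\<delta> / 2) / sqrt \<epsilon>)\<^sup>2" using R R0 by (intro power_mono) auto
      then have "R\<^sup>2 \<le> \<delta> / (2 * \<epsilon>)" using \<epsilon> \<delta> by (simp add: power_divide)
      then have "R\<^sup>2 * m\<^sup>2 \<le> \<delta> / (2 * \<epsilon>) * (2 * \<epsilon> / \<delta>)" using near \<epsilon> \<delta> by (intro mult_mono) auto
      then have "(R * m)\<^sup>2 \<le> 1" using \<epsilon> \<delta> by (simp add: power_mult_distrib)
      then have "\<bar>R * m\<bar> / 2 \<le> \<bar>sin (R * m)\<bar>"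
        by (intro half_abs_le_abs_sin) (simp add: abs_square_le_1)
      then have "(\<bar>R * m\<bar> / 2)\<^sup>2 \<le> \<bar>sin (R * m)\<bar>\<^sup>2" by (intro power_mono) auto
      then have sin: "R\<^sup>2 * m\<^sup>2 / 4 \<le> (sin (R * m))\<^sup>2" by (simp add: power_divide power_mult_distrib)
      have "(4 * exp 2 * sqrt \<epsilon>)\<^sup>2 \<le> R\<^sup>2" using R \<epsilon> by (intro power_mono) auto
      moreover have "(exp 2)\<^sup>2 = exp (4::real)" by (simp flip: exp_double)
      ultimately have R2: "16 * exp 4 * \<epsilon> \<le> R\<^sup>2" using \<epsilon> by (simp add: power_mult_distrib)
      have "16 * exp 4 * \<epsilon> * m\<^sup>2 \<le> R\<^sup>2 * m\<^sup>2" using R2 by (intro mult_right_mono) auto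
      then have sin': "exp 4 * (4 * \<epsilon> * m\<^sup>2) \<le> (sin (R * m))\<^sup>2" using sin by simp
      have "y\<^sup>2 \<le> 4"
      proof -
        have "\<alpha>\<^sup>2 \<le> (3 / 2)\<^sup>2" using \<alpha> by (intro power_mono) auto
        then have "\<alpha>\<^sup>2 * m\<^sup>2 \<le> (3 / 2)\<^sup>2 * 1" using m1 by (intro mult_mono) auto
        then show ?thesis unfolding y_def power_mult_distrib by (simp add: power_divide)
      qed
      then have c4: "exp (y\<^sup>2) \<le> exp 4" by simp
      have "(cosh y)\<^sup>2 - (sin (R * m))\<^sup>2 \<le> exp (y\<^sup>2) - exp 4 * (4 * \<epsilon> * m\<^sup>2)"
        using sin' cosh_squared_le[of y] by linarith
      also have "\<dots> \<le> exp (y\<^sup>2) - exp (y\<^sup>2) * (4 * \<epsilon> * m\<^sup>2)"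
        using c4 \<epsilon> by (intro diff_left_mono mult_right_mono) auto
      also have "\<dots> = exp (y\<^sup>2) * (1 + - (4 * \<epsilon> * m\<^sup>2))" by (simp add: algebra_simps)
      also have "\<dots> \<le> exp (y\<^sup>2) * exp (- (4 * \<epsilon> * m\<^sup>2))"
        by (intro mult_left_mono exp_ge_add_one_self) auto
      finally have "exp (- \<alpha> * m\<^sup>2) * ((cosh y)\<^sup>2 - (sin (R * m))\<^sup>2) \<le>
          exp (- \<alpha> * m\<^sup>2) * (exp (y\<^sup>2) * exp (- (4 * \<epsilon> * m\<^sup>2)))"
        by (intro mult_left_mono) auto
      also have "\<dots> = exp (- \<alpha> * m\<^sup>2 + (y\<^sup>2 + - (4 * \<epsilon> * m\<^sup>2)))" by (simp only: exp_add)
      also have "\<dots> \<le> exp (- \<epsilon> * m\<^sup>2)"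
      proof -
        have "0 \<le> \<epsilon> * m\<^sup>2" using \<epsilon> by simp
        then show ?thesis using y2 \<alpha>\<epsilon> by simp
      qed
      finally show ?thesis .
    next
      case middle
      \<comment> \<open>Here \<open>2 * \<delta> * y ^ 4\<close> is at least \<open>4 * \<epsilon> * m\<^sup>2\<close> and outweighs the growth \<open>\<alpha> * \<epsilon> * m\<^sup>2\<close>.\<close>
      have "\<bar>y\<bar> \<le> 3 / 2 * 4" unfolding y_def abs_mult using middle \<alpha> by (intro mult_mono) auto
      then have "\<bar>y\<bar>\<^sup>2 \<le> 6\<^sup>2" by (intro power_mono) auto
      then have "exp (- 18) \<le> exp (- (y\<^sup>2 / 2))" by simp
      then have "y ^ 4 * exp (- 18) \<le> y ^ 4 * exp (- (y\<^sup>2 / 2))" by (intro mult_left_mono) auto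
      then have "cosh y \<le> exp (y\<^sup>2 / 2 - \<delta> * y ^ 4)"
        using cosh_le_exp_quartic[of y] by (elim order_trans) (simp add: \<delta>_def mult.commute)
      then have "(cosh y)\<^sup>2 \<le> (exp (y\<^sup>2 / 2 - \<delta> * y ^ 4))\<^sup>2" by (intro power_mono) auto
      also have "\<dots> = exp (y\<^sup>2 - 2 * \<delta> * y ^ 4)" by (simp flip: exp_double)
      finally have "exp (- \<alpha> * m\<^sup>2) * ((cosh y)\<^sup>2 - (sin (R * m))\<^sup>2) \<le> exp (- \<alpha> * m\<^sup>2) * exp (y\<^sup>2 - 2 * \<delta> * y ^ 4)"
        by (intro mult_left_mono) (auto intro: order_trans[rotated])
      also have "\<dots> = exp (- \<alpha> * m\<^sup>2 + (y\<^sup>2 - 2 * \<delta> * y ^ 4))" by (simp only: exp_add)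
      also have "\<dots> \<le> exp (- \<epsilon> * m\<^sup>2)"
      proof -
        have "1 * m ^ 4 \<le> \<alpha> ^ 4 * m ^ 4" using \<alpha> by (intro mult_right_mono) (auto simp: one_le_power)
        then have "2 * \<delta> * m ^ 4 \<le> 2 * \<delta> * y ^ 4"
          using \<delta> by (simp add: y_def power_mult_distrib)
        moreover have "2 * \<epsilon> * m\<^sup>2 \<le> \<delta> * m\<^sup>2 * m\<^sup>2"
          using middle \<delta> by (intro mult_right_mono) (auto simp: field_simps)
        then have "4 * \<epsilon> * m\<^sup>2 \<le> 2 * \<delta> * m ^ 4" by (simp add: power2_eq_square power4_eq_xxxx)
        moreover have "0 \<le> \<epsilon> * m\<^sup>2" using \<epsilon> by simp
        ultimately show ?thesis using y2 \<alpha>\<epsilon> by simp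
      qed
      finally show ?thesis .
    next
      case far
      have "cosh y \<le> exp \<bar>y\<bar>"
      proof -
        have "0 \<le> sinh \<bar>y\<bar>" by simp
        then have "cosh \<bar>y\<bar> \<le> exp \<bar>y\<bar>"
          unfolding cosh_plus_sinh[symmetric] by (rule le_add_same_cancel1[THEN iffD2])
        then show ?thesis by simp
      qed
      then have "(cosh y)\<^sup>2 \<le> (exp \<bar>y\<bar>)\<^sup>2" by (intro power_mono) auto
      also have "\<dots> = exp (2 * \<bar>y\<bar>)" by (simp flip: exp_double)
      finally have "exp (- \<alpha> * m\<^sup>2) * ((cosh y)\<^sup>2 - (sin (R * m))\<^sup>2) \<le> exp (- \<alpha> * m\<^sup>2) * exp (2 * \<bar>y\<bar>)"
        by (intro mult_left_mono) (auto intro: order_trans[rotated])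
      also have "\<dots> = exp (- \<alpha> * m\<^sup>2 + 2 * \<bar>y\<bar>)" by (simp only: exp_add)
      also have "\<dots> \<le> exp (- \<epsilon> * m\<^sup>2)"
      proof -
        have "4 * \<bar>m\<bar> \<le> \<bar>m\<bar> * \<bar>m\<bar>" using far by (intro mult_right_mono) auto
        then have "4 * \<bar>m\<bar> \<le> m\<^sup>2" by (simp add: power2_eq_square)
        then have "\<alpha> * (4 * \<bar>m\<bar>) \<le> \<alpha> * m\<^sup>2" using \<alpha> by (intro mult_left_mono) auto
        moreover have "\<bar>y\<bar> = \<alpha> * \<bar>m\<bar>" using \<alpha> by (simp add: y_def abs_mult)
        moreover have "2 * \<epsilon> * m\<^sup>2 \<le> \<alpha> * m\<^sup>2" using \<epsilon> \<delta> \<alpha> by (intro mult_right_mono) auto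
        ultimately show ?thesis by simp
      qed
      finally show ?thesis .
    qed
  qed
  then show "exp (- Re \<beta> * m\<^sup>2) * ((cosh (Re \<beta> * m))\<^sup>2 - (sin (Im \<beta> * m))\<^sup>2) \<le> exp (- (2 * (\<epsilon> / 2)) * m\<^sup>2)"
    by (simp add: \<beta> \<alpha>_def y_def)
qed

section \<open>Asymptotics of the partition function\<close>

lemma cw_ratio_ne_0:
  assumes "\<beta> \<noteq> 1"
  shows "cw_ratio \<beta> \<noteq> 0"
  using assms by (auto simp: cw_ratio_def power2_eq_square)

lemma tendsto_nonzero_imp_relative:
  fixes f :: "nat \<Rightarrow> complex"
  assumes "f \<longlonglongrightarrow> L" "L \<noteq> 0"
  shows "\<exists>\<delta>. \<delta> \<longlonglongrightarrow> 0 \<and> (\<forall>N\<ge>1. f N = L * (1 + \<delta> N))"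
proof (intro exI conjI)
  have "(\<lambda>N. f N / L - 1) \<longlonglongrightarrow> L / L - 1" using assms by (intro tendsto_intros)
  then show "(\<lambda>N. f N / L - 1) \<longlonglongrightarrow> 0" using assms by simp
qed (use assms in auto)

lemma tendsto_nonzero_imp_log_rate_0:
  fixes f :: "nat \<Rightarrow> complex"
  assumes "f \<longlonglongrightarrow> L" "L \<noteq> 0"
  shows "(\<lambda>N. 1 / real N * ln (cmod (f N))) \<longlonglongrightarrow> 0"
proof -
  have "(\<lambda>N. 1 / real N * ln (cmod (f N))) \<longlonglongrightarrow> 0 * ln (cmod L)"
    using assms by (intro tendsto_intros lim_1_over_n) auto
  then show ?thesis by simp
qed

theorem theorem1p1:
  "\<exists>c c' \<epsilon>\<^sub>0 :: real. c > 0 \<and> c' > 0 \<and> \<epsilon>\<^sub>0 > 0 \<and>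
     (\<forall>(\<epsilon>::real) (R::real) (\<beta>::complex).
        \<beta> = 1 + complex_of_real \<epsilon> + \<i> * complex_of_real R \<longrightarrow>
        (0 < \<epsilon> \<and> \<epsilon> \<le> \<epsilon>\<^sub>0 \<and> c * sqrt \<epsilon> \<le> R \<and> R \<le> c' / sqrt \<epsilon>) \<or> \<epsilon> < 0 \<longrightarrow>
        (\<exists>\<delta> :: nat \<Rightarrow> complex. \<delta> \<longlonglongrightarrow> 0 \<and>
           (\<forall>N\<ge>1. cw_partition \<beta> N = csqrt (cw_ratio \<beta>) * (1 + \<delta> N))) \<and>
        (\<lambda>N. 1 / real N * ln (cmod (cw_partition \<beta> N))) \<longlonglongrightarrow> 0)"
proof -
  \<comment> \<open>The constant \<open>\<delta>\<close> of the decay estimate.\<close>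
  define d :: real where "d = exp (- 18) / 12"
  have main: "cw_partition \<beta> \<longlonglongrightarrow> csqrt (cw_ratio \<beta>) \<and> csqrt (cw_ratio \<beta>) \<noteq> 0"
    if \<beta>: "\<beta> = 1 + complex_of_real \<epsilon> + \<i> * complex_of_real R"
      and h: "(0 < \<epsilon> \<and> \<epsilon> \<le> d / 2 \<and> 4 * exp 2 * sqrt \<epsilon> \<le> R \<and> R \<le> sqrt (d / 2) / sqrt \<epsilon>) \<or> \<epsilon> < 0"
    for \<epsilon> R \<beta>
  proof
    have Re: "Re \<beta> = 1 + \<epsilon>" by (simp add: \<beta>)
    show "csqrt (cw_ratio \<beta>) \<noteq> 0"
    proof -
      have "\<epsilon> \<noteq> 0" using h by linarith
      then have "\<beta> \<noteq> 1" using Re by auto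
      then show ?thesis using cw_ratio_ne_0 csqrt_eq_0 by blast
    qed
    consider (supercritical) "0 < \<epsilon>" "\<epsilon> \<le> d / 2" "4 * exp 2 * sqrt \<epsilon> \<le> R" "R \<le> sqrt (d / 2) / sqrt \<epsilon>"
      | (subcritical) "\<epsilon> < 0" "Re \<beta> > 0" | (nonpos) "Re \<beta> \<le> 0"
      using h by linarith
    then show "cw_partition \<beta> \<longlonglongrightarrow> csqrt (cw_ratio \<beta>)"
    proof cases
      case supercritical
      show ?thesis
        by (rule cw_partition_tendsto_if_gaussian_decay[OF _ _ decay_supercritical[OF supercritical[unfolded d_def] \<beta>]])
           (use supercritical Re in auto)
    next
      case subcritical
      show ?thesis
        by (rule cw_partition_tendsto_if_gaussian_decay[OF _ _ decay_subcritical])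
           (use subcritical Re in \<open>auto simp: mult_pos_neg\<close>)
    next
      case nonpos
      then show ?thesis by (rule cw_partition_tendsto_nonpos)
    qed
  qed
  show ?thesis
  proof (rule exI[of _ "4 * exp 2"], rule exI[of _ "sqrt (d / 2)"], rule exI[of _ "d / 2"],
      intro conjI allI impI)
    show "4 * exp 2 > (0::real)" "sqrt (d / 2) > 0" "d / 2 > 0" by (auto simp: d_def)
  next
    fix \<epsilon> R :: real and \<beta> :: complex
    assume "\<beta> = 1 + complex_of_real \<epsilon> + \<i> * complex_of_real R"
      and "(0 < \<epsilon> \<and> \<epsilon> \<le> d / 2 \<and> 4 * exp 2 * sqrt \<epsilon> \<le> R \<and> R \<le> sqrt (d / 2) / sqrt \<epsilon>) \<or> \<epsilon> < 0"
    note lim = main[OF this]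
    show "\<exists>\<delta>. \<delta> \<longlonglongrightarrow> 0 \<and> (\<forall>N\<ge>1. cw_partition \<beta> N = csqrt (cw_ratio \<beta>) * (1 + \<delta> N))"
      using lim by (intro tendsto_nonzero_imp_relative) auto
    show "(\<lambda>N. 1 / real N * ln (cmod (cw_partition \<beta> N))) \<longlonglongrightarrow> 0"
      using lim by (intro tendsto_nonzero_imp_log_rate_0) auto
  qed
qed

end
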